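(* Let $\lambda_1\ge\lambda_2\ge2$ and $h_1\ge h_2\ge 2$ be integers and let $\lambda=(\lambda_1,\lambda_2,2^{h_2-2},1^{h_1-h_2})$, a partition of $n=\lambda_1+\lambda_2+h_1+h_2-4$. If $h_1\le m\le n-(\lambda_1-1)$, then $$|\mathrm{QYT}_{=m}(\lambda)|=\frac{\lambda_1-\lambda_2+1}{m-h_2+1}\binom{\lambda_1+h_1-2}{m-h_2}\binom{\lambda_2+h_1-3}{m-h_2}\binom{m-h_2}{m-h_1}\binom{\lambda_2+h_2-4}{h_2-2}\binom{\lambda_1+h_2-3}{h_2-2}\frac{1}{\binom{h_1-1}{h_2-2}}.$$
   Context: The notation $(\lambda_1,\lambda_2,2^{h_2-2},1^{h_1-h_2})$ denotes the partition with rows of lengths $\lambda_1,\lambda_2$, followed by $h_2-2$ rows of length $2$, followed by $h_1-h_2$ rows of length $1$; it has Durfee size $2$, first column of height $h_1$ and second column of height $h_2$. The (French) Young diagram has $\lambda_j$ left-justified boxes in row $j$, rows numbered from bottom to top. A semistandard Young tableau (SSYT) of shape $\lambda$ is a filling of the boxes with positive integers weakly increasing left to right along rows and strictly increasing bottom to top along columns. An SSYT $T$ is quasi-Yamanouchi if for every integer $i>1$ appearing in $T$, the leftmost occurrence of $i$ lies in a column weakly left of (column index $\le$) some occurrence of $i-1$. $\mathrm{QYT}_{=m}(\lambda)$ is the set of quasi-Yamanouchi tableaux of shape $\lambda$ whose largest entry is exactly $m$. *)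

theory Defs
  imports Complex_Main
begin

text \<open>A partition is given by its list of row lengths (row 0 = bottom row, French).
  Boxes are pairs (row, column), both 0-indexed.\<close>

definition young_diagram :: "nat list \<Rightarrow> (nat \<times> nat) set" where
  "young_diagram lam = {(r, c). r < length lam \<and> c < lam ! r}"

text \<open>A filling is a function on all pairs, required to be 0 outside the diagram
  (so that fillings of a shape correspond bijectively to functions on its boxes).\<close>

definition is_SSYT :: "nat list \<Rightarrow> (nat \<times> nat \<Rightarrow> nat) \<Rightarrow> bool" where
  "is_SSYT lam T \<longleftrightarrow>
     (\<forall>b \<in> young_diagram lam. 0 < T b) \<and>
     (\<forall>b. b \<notin> young_diagram lam \<longrightarrow> T b = 0) \<and>
     (\<forall>r c c'. (r, c) \<in> young_diagram lam \<and> (r, c') \<in> young_diagram lam \<and> c \<le> c'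
        \<longrightarrow> T (r, c) \<le> T (r, c')) \<and>
     (\<forall>r r' c. (r, c) \<in> young_diagram lam \<and> (r', c) \<in> young_diagram lam \<and> r < r'
        \<longrightarrow> T (r, c) < T (r', c))"

definition leftmost_col :: "nat list \<Rightarrow> (nat \<times> nat \<Rightarrow> nat) \<Rightarrow> nat \<Rightarrow> nat" where
  "leftmost_col lam T i = Min {c. \<exists>r. (r, c) \<in> young_diagram lam \<and> T (r, c) = i}"

definition is_quasi_yamanouchi :: "nat list \<Rightarrow> (nat \<times> nat \<Rightarrow> nat) \<Rightarrow> bool" where
  "is_quasi_yamanouchi lam T \<longleftrightarrow>
     (\<forall>i. 1 < i \<and> i \<in> T ` young_diagram lam \<longrightarrow>
        (\<exists>b \<in> young_diagram lam. T b = i - 1 \<and> leftmost_col lam T i \<le> snd b))"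

definition QYT_eq :: "nat list \<Rightarrow> nat \<Rightarrow> (nat \<times> nat \<Rightarrow> nat) set" where
  "QYT_eq lam m = {T. is_SSYT lam T \<and> is_quasi_yamanouchi lam T
                      \<and> Max (T ` young_diagram lam) = m}"

definition two_column_shape :: "nat \<Rightarrow> nat \<Rightarrow> nat \<Rightarrow> nat \<Rightarrow> nat list" where
  "two_column_shape l1 l2 h1 h2 = [l1, l2] @ replicate (h2 - 2) 2 @ replicate (h1 - h2) 1"

end

theory Submission
  imports Defs
begin

text \<open>
  In a quasi-Yamanouchi tableau with largest entry m, the rightmost m sits in a corner p of the
  shape. Deleting it leaves a quasi-Yamanouchi tableau of the smaller shape; its largest entry is m if
  all its maximal entries lie strictly left of p, and m - 1 if one of them lies weakly right of p.
  Conversely, the column of p relative to the rightmost maximal entry decides which value may be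
  placed in p. A shape of Durfee size 2 has at most four corners. When p is the end of the first row
  or of the first column there is no condition on the remaining tableau; when p is one of the inner
  two corners, the condition only concerns whether the next maximal entry sits at the end of the
  first row (respectively column), and such tableaux are again counted by deleting that box. Hence
  the numbers satisfy a linear recurrence with constant coefficients, whose boundary values come from
  hooks. After cancelling factorials, the product formula satisfies the same recurrence because of
  a polynomial identity in the Frobenius coordinates of the shape.
\<close>

section \<open>The product formula and its recurrence\<close>

text \<open>With the reciprocal factorial extended by 0 to negative integers, the closed formula below
  vanishes automatically whenever the removal of a box does not leave a valid shape.\<close>

definition inv_fact :: "int \<Rightarrow> real" where
  "inv_fact x = (if x < 0 then 0 else 1 / fact (nat x))"

text \<open>No sign condition on \<open>x\<close> is required: for \<open>x \<le> 0\<close> both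
  sides vanish by the convention. Arguments of \<open>descent_formula\<close> can thus be lowered
  without case distinctions.\<close>

lemma inv_fact_minus_one: "inv_fact (x - 1) = of_int x * inv_fact x"
proof (cases "x \<ge> 1")
  case True
  then have "nat x = Suc (nat (x - 1))" by simp
  then have "fact (nat x) = of_int x * (fact (nat (x - 1)) :: real)"
    using True by (simp add: of_nat_nat)
  then show ?thesis using True by (simp add: inv_fact_def)
qed (auto simp: inv_fact_def)

lemma fact_nat_reduce:
  fixes x :: int
  assumes "x \<ge> 1"
  shows "fact (nat x) = of_int x * (fact (nat (x - 1)) :: real)"
proof -
  have "nat x = Suc (nat (x - 1))" using assms by simp
  then show ?thesis using assms by (simp add: of_nat_nat)
qed

text \<open>The number of quasi-Yamanouchi tableaux with largest entry k + 1, in terms of the Frobenius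
  coordinates (a, b | c, d) of the shape, where a > b and c > d.\<close>

definition descent_formula :: "int \<Rightarrow> int \<Rightarrow> int \<Rightarrow> int \<Rightarrow> int \<Rightarrow> real" where
  "descent_formula a b c d k =
     of_int (a - b) * of_int (c - d)
     * (fact (nat (a + c)) * fact (nat (b + c)) * fact (nat (b + d)) * fact (nat (a + d)))
     * (inv_fact a * inv_fact b * inv_fact c * inv_fact d)
     * (inv_fact (k - d) * inv_fact (k - c)
        * inv_fact (a + c + d + 1 - k) * inv_fact (b + c + d + 1 - k))"

text \<open>Either a linear factor or a reciprocal factorial at -1 vanishes. These parameters arise
  when the box to be removed is not a corner, so the recurrence needs no case distinctions at the
  boundary.\<close>

lemma descent_formula_walls [simp]:
  "descent_formula a a c d k = 0" "descent_formula a b c c k = 0"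
  "descent_formula a (-1) c d k = 0" "descent_formula a b c (-1) k = 0"
  by (simp_all add: descent_formula_def inv_fact_def)

text \<open>The first two summands correspond to the ends of the first row and of the first column,
  the two brackets to the two inner corners. Every summand is a polynomial times one common factor,
  which leaves a polynomial identity. The last hypothesis makes \<open>b + d\<close> positive, so
  that its factorial can be reduced too.\<close>

lemma descent_formula_recurrence:
  assumes "0 \<le> b" "b < a" "0 \<le> d" "d < c" and "b \<noteq> 0 \<or> d \<noteq> 0"
  shows "descent_formula a b c d k =
      descent_formula (a - 1) b c d k + descent_formula a b (c - 1) d (k - 1)
    + (descent_formula a (b - 1) c d k
       - descent_formula (a - 1) (b - 1) c d k + descent_formula (a - 1) (b - 1) c d (k - 1))
    + (descent_formula a b c (d - 1) (k - 1)
       - descent_formula a b (c - 1) (d - 1) (k - 2) + descent_formula a b (c - 1) (d - 1) (k - 1))"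
proof -
  \<comment> \<open>These are the smallest factorials that occur in any summand; the larger ones are
    linear multiples of them.\<close>
  define P Q R S :: real where "P = fact (nat (a + c - 1))" and "Q = fact (nat (b + c - 1))"
    and "R = fact (nat (b + d - 1))" and "S = fact (nat (a + d - 1))"
  define V where "V = inv_fact a * inv_fact b * inv_fact c * inv_fact d"
  define W where "W = inv_fact (k - d) * inv_fact (k - c)
        * inv_fact (a + c + d + 1 - k) * inv_fact (b + c + d + 1 - k)"
  define a' b' c' d' k' where "a' = real_of_int a" and "b' = real_of_int b"
    and "c' = real_of_int c" and "d' = real_of_int d" and "k' = real_of_int k"
  define x y where "x = a' + c' + d' + 1 - k'" and "y = b' + c' + d' + 1 - k'"
  note real_defs = a'_def b'_def c'_def d'_def k'_def
  note facts = P_def Q_def R_def S_def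
  have full: "fact (nat (a + c)) = (a' + c') * P" "fact (nat (b + c)) = (b' + c') * Q"
    "fact (nat (b + d)) = (b' + d') * R" "fact (nat (a + d)) = (a' + d') * S"
    unfolding facts real_defs using assms by (subst fact_nat_reduce; force)+
  \<comment> \<open>Normal forms that bring every shifted argument to the unshifted one or to one
    less, where \<open>inv_fact_minus_one\<close> applies; \<open>u\<close> stands for
    \<open>a + c\<close>, \<open>b + c\<close> or a lowered version of these.\<close>
  have shift:
    "a - 1 + c = a + c - 1" "a - 1 + d = a + d - 1" "b - 1 + c = b + c - 1" "b - 1 + d = b + d - 1"
    "a + (c - 1) = a + c - 1" "b + (c - 1) = b + c - 1"
    "a + (d - 1) = a + d - 1" "b + (d - 1) = b + d - 1"
    "\<And>u. u - 1 + d = u + d - 1" "\<And>u. u + (d - 1) = u + d - 1"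
    "\<And>u. u + d - 1 + 1 - (k - 1) = u + d + 1 - k"
    "\<And>u. u + d - 1 + 1 - k = u + d + 1 - k - 1"
    "\<And>u. u + d - 1 - 1 + 1 - (k - 1) = u + d + 1 - k - 1"
    "\<And>u. u + d - 1 - 1 + 1 - (k - 2) = u + d + 1 - k"
    "k - 1 - d = k - d - 1" "k - 1 - c = k - c - 1" "k - 1 - (c - 1) = k - c" "k - 1 - (d - 1) = k - d"
    "k - 2 - (d - 1) = k - d - 1" "k - 2 - (c - 1) = k - c - 1"
    by simp_all
  note expand = descent_formula_def shift inv_fact_minus_one full P_def[symmetric] Q_def[symmetric]
    R_def[symmetric] S_def[symmetric]
  note fold_real = of_int_diff of_int_add of_int_1 real_defs[symmetric]
  define U where "U = P * Q * R * S * V * W"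
  note parts = U_def V_def W_def x_def y_def
  have F: "descent_formula a b c d k
      = U * ((a' - b') * (c' - d') * (a' + c') * (a' + d') * (b' + c') * (b' + d'))"
    by (simp only: expand parts fold_real) (simp only: mult_ac)
  have T1: "descent_formula (a - 1) b c d k
      = U * ((a' - 1 - b') * (c' - d') * a' * x * (b' + c') * (b' + d'))"
    by (simp only: expand parts fold_real) (simp only: mult_ac)
  have T2: "descent_formula a (b - 1) c d k
      = U * ((a' - (b' - 1)) * (c' - d') * b' * y * (a' + c') * (a' + d'))"
    by (simp only: expand parts fold_real) (simp only: mult_ac)
  have T3: "descent_formula a b c (d - 1) (k - 1)
      = U * ((a' - b') * (c' - (d' - 1)) * d' * (k' - c') * (a' + c') * (b' + c'))"
    by (simp only: expand parts fold_real) (simp only: mult_ac)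
  have T4: "descent_formula a b (c - 1) d (k - 1)
      = U * ((a' - b') * (c' - 1 - d') * c' * (k' - d') * (a' + d') * (b' + d'))"
    by (simp only: expand parts fold_real) (simp only: mult_ac)
  have T12: "descent_formula (a - 1) (b - 1) c d k
      = U * ((a' - 1 - (b' - 1)) * (c' - d') * a' * b' * x * y)"
    by (simp only: expand parts fold_real) (simp only: mult_ac)
  have T12': "descent_formula (a - 1) (b - 1) c d (k - 1)
      = U * ((a' - 1 - (b' - 1)) * (c' - d') * a' * b' * (k' - d') * (k' - c'))"
    by (simp only: expand parts fold_real) (simp only: mult_ac)
  have T34: "descent_formula a b (c - 1) (d - 1) (k - 2)
      = U * ((a' - b') * (c' - 1 - (d' - 1)) * c' * d' * (k' - d') * (k' - c'))"
    by (simp only: expand parts fold_real) (simp only: mult_ac)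
  have T34': "descent_formula a b (c - 1) (d - 1) (k - 1)
      = U * ((a' - b') * (c' - 1 - (d' - 1)) * c' * d' * x * y)"
    by (simp only: expand parts fold_real) (simp only: mult_ac)
  \<comment> \<open>What remains is \<open>U\<close> times an identity of polynomials of degree six
    in the five real parameters.\<close>
  show ?thesis
    unfolding F T1 T2 T3 T4 T12 T12' T34 T34' x_def y_def by algebra
qed

text \<open>For \<open>b = d = 0\<close> the factors \<open>inv_fact (k - c)\<close> and
  \<open>inv_fact (c + 1 - k)\<close> leave only these two values of \<open>k\<close> with a
  possibly nonzero result.\<close>

lemma descent_formula_near_hook:
  "descent_formula (int a) 0 (int c) 0 (int c) = real a * real c * fact (a + c) / (fact c * fact (Suc a))"
  "descent_formula (int a) 0 (int c) 0 (int c + 1) = real a * real c * fact (a + c) / (fact (Suc c) * fact a)"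
proof -
  have "nat (int a + 1) = Suc a" "nat (int c + 1) = Suc c" "nat (int a + int c) = a + c" by simp_all
  then show "descent_formula (int a) 0 (int c) 0 (int c) = real a * real c * fact (a + c) / (fact c * fact (Suc a))"
    "descent_formula (int a) 0 (int c) 0 (int c + 1) = real a * real c * fact (a + c) / (fact (Suc c) * fact a)"
    by (simp_all add: descent_formula_def inv_fact_def del: fact_Suc)
qed

text \<open>The case left out by \<open>descent_formula_recurrence\<close>. Here the only inner
  corner is (1, 1), whose removal leaves a hook; the two binomials are the resulting hook
  counts.\<close>

lemma descent_formula_near_hook_recurrence:
  fixes a c :: nat and k :: int
  shows "descent_formula (int (Suc a)) 0 (int (Suc c)) 0 k =
      descent_formula (int a) 0 (int (Suc c)) 0 k + descent_formula (int (Suc a)) 0 (int c) 0 (k - 1)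
    + (if k = int c + 1 then real (Suc (a + c) choose c) else 0)
    + (if k = int c + 2 then real (Suc (a + c) choose Suc c) else 0)"
proof -
  consider "k = int (Suc c)" | "k = int (Suc c) + 1" | "k < int (Suc c)" | "k > int (Suc c) + 1" by linarith
  then show ?thesis
  proof cases
    case 1
    have "k - 1 = int c" using 1 by simp
    then have e: "descent_formula (int (Suc a)) 0 (int c) 0 (k - 1) =
        real (Suc a) * real c * fact (Suc a + c) / (fact c * fact (Suc (Suc a)))"
      by (simp only: descent_formula_near_hook)
    have "real (Suc (a + c) choose c) = fact (Suc (a + c)) / (fact c * fact (Suc a))"
      using binomial_fact[of c "Suc (a + c)", where 'a = real] by (simp add: Suc_diff_le)
    then have "(if k = int c + 1 then real (Suc (a + c) choose c) else 0)
        = fact (Suc (a + c)) / (fact c * fact (Suc a))"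
      "(if k = int c + 2 then real (Suc (a + c) choose Suc c) else 0) = 0"
      using 1 by simp_all
    then show ?thesis unfolding e unfolding \<open>k = int (Suc c)\<close> descent_formula_near_hook
      by (simp only:) (simp add: divide_simps, simp add: algebra_simps)
  next
    case 2
    have "k - 1 = int c + 1" using 2 by simp
    then have e: "descent_formula (int (Suc a)) 0 (int c) 0 (k - 1) =
        real (Suc a) * real c * fact (Suc a + c) / (fact (Suc c) * fact (Suc a))"
      by (simp only: descent_formula_near_hook)
    have "real (Suc (a + c) choose Suc c) = fact (Suc (a + c)) / (fact (Suc c) * fact a)"
      using binomial_fact[of "Suc c" "Suc (a + c)", where 'a = real] by simp
    then have "(if k = int c + 1 then real (Suc (a + c) choose c) else 0) = 0"
      "(if k = int c + 2 then real (Suc (a + c) choose Suc c) else 0)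
        = fact (Suc (a + c)) / (fact (Suc c) * fact a)"
      using 2 by simp_all
    then show ?thesis unfolding e unfolding \<open>k = int (Suc c) + 1\<close> descent_formula_near_hook
      by (simp only:) (simp add: divide_simps, simp add: algebra_simps)
  \<comment> \<open>For all other \<open>k\<close> every term is 0, since a reciprocal factorial has
    a negative argument.\<close>
  qed (auto simp: descent_formula_def inv_fact_def)
qed

section \<open>Removing the rightmost maximal entry\<close>

text \<open>Stated for a set of boxes instead of a list of row lengths, so that deleting a box is a
  set difference.\<close>

definition ssyt :: "(nat \<times> nat) set \<Rightarrow> (nat \<times> nat \<Rightarrow> nat) \<Rightarrow> bool" where
  "ssyt D T \<longleftrightarrow>
     (\<forall>b\<in>D. 0 < T b) \<and> (\<forall>b. b \<notin> D \<longrightarrow> T b = 0) \<and>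
     (\<forall>r c c'. (r, c) \<in> D \<and> (r, c') \<in> D \<and> c \<le> c' \<longrightarrow> T (r, c) \<le> T (r, c')) \<and>
     (\<forall>r r' c. (r, c) \<in> D \<and> (r', c) \<in> D \<and> r < r' \<longrightarrow> T (r, c) < T (r', c))"

text \<open>The leftmost \<open>i\<close> is weakly left of a box exactly if some \<open>i\<close>
  is, so the minimum in the original condition can be replaced by an existential.\<close>

definition quasi_yam :: "(nat \<times> nat) set \<Rightarrow> (nat \<times> nat \<Rightarrow> nat) \<Rightarrow> bool" where
  "quasi_yam D T \<longleftrightarrow>
     (\<forall>i. 1 < i \<and> i \<in> T ` D \<longrightarrow>
        (\<exists>b\<in>D. \<exists>b'\<in>D. T b = i - 1 \<and> T b' = i \<and> snd b' \<le> snd b))"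

text \<open>The largest entry is an integer so that \<open>m - 1\<close> and \<open>m - 2\<close>
  never truncate; for nonempty \<open>D\<close> and \<open>m \<le> 0\<close> the set is
  empty.\<close>

definition qyt :: "(nat \<times> nat) set \<Rightarrow> int \<Rightarrow> (nat \<times> nat \<Rightarrow> nat) set" where
  "qyt D m = {T. ssyt D T \<and> quasi_yam D T \<and> int (Max (T ` D)) = m}"

definition qyt_last :: "(nat \<times> nat) set \<Rightarrow> int \<Rightarrow> nat \<times> nat \<Rightarrow> (nat \<times> nat \<Rightarrow> nat) set" where
  "qyt_last D m p = {T \<in> qyt D m. p \<in> D \<and> int (T p) = m \<and> (\<forall>b\<in>D. int (T b) = m \<longrightarrow> snd b \<le> snd p)}"

definition corners :: "(nat \<times> nat) set \<Rightarrow> (nat \<times> nat) set" where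
  "corners D = {p \<in> D. (\<forall>c. (fst p, c) \<in> D \<longrightarrow> c \<le> snd p) \<and> (\<forall>r. (r, snd p) \<in> D \<longrightarrow> r \<le> fst p)}"

lemma ssytD:
  assumes "ssyt D T"
  shows "b \<in> D \<Longrightarrow> 0 < T b" "b \<notin> D \<Longrightarrow> T b = 0"
    "(r, c) \<in> D \<Longrightarrow> (r, c') \<in> D \<Longrightarrow> c \<le> c' \<Longrightarrow> T (r, c) \<le> T (r, c')"
    "(r, c) \<in> D \<Longrightarrow> (r', c) \<in> D \<Longrightarrow> r < r' \<Longrightarrow> T (r, c) < T (r', c)"
  using assms unfolding ssyt_def by blast+

section \<open>The corner holding the rightmost maximal entry\<close>

lemma finite_qyt:
  assumes "finite D"
  shows "finite (qyt D m)"
proof (rule finite_subset)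
  show "qyt D m \<subseteq> {T. \<forall>b. (b \<in> D \<longrightarrow> T b \<in> {..nat m}) \<and> (b \<notin> D \<longrightarrow> T b = 0)}"
    using assms by (auto simp: qyt_def ssyt_def)
  show "finite {T. \<forall>b. (b \<in> D \<longrightarrow> T b \<in> {..nat m}) \<and> (b \<notin> D \<longrightarrow> T b = (0::nat))}"
    using assms by (intro finite_set_of_finite_funs) auto
qed

lemma finite_qyt_last: "finite D \<Longrightarrow> finite (qyt_last D m p)"
  using finite_qyt[of D m] by (auto simp: qyt_last_def)

lemma corners_subset: "corners D \<subseteq> D"
  by (auto simp: corners_def)

lemma qyt_le:
  assumes "finite D" "T \<in> qyt D m" "b \<in> D"
  shows "int (T b) \<le> m"
  using assms by (auto simp: qyt_def)

text \<open>Columns increase strictly. Hence the rightmost maximal entry is a well-defined box, and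
  the sets \<open>qyt_last D m p\<close> for different \<open>p\<close> are disjoint.\<close>

lemma qyt_same_column:
  assumes "T \<in> qyt D m" "b \<in> D" "b' \<in> D" "T b = T b'" "snd b = snd b'"
  shows "b = b'"
proof -
  obtain r c r' where b: "b = (r, c)" "b' = (r', c)" using assms(5) by (metis prod.collapse)
  have "ssyt D T" using assms(1) by (simp add: qyt_def)
  then show ?thesis using assms(2-4) ssytD(4)[of D T r c r'] ssytD(4)[of D T r' c r] b
    by (cases r r' rule: linorder_cases) auto
qed

lemma qyt_last_disjoint:
  assumes "p \<noteq> q"
  shows "qyt_last D m p \<inter> qyt_last D m q = {}"
proof -
  have False if T: "T \<in> qyt_last D m p" "T \<in> qyt_last D m q" for T
  proof -
    have "snd p \<le> snd q" "snd q \<le> snd p" using T unfolding qyt_last_def by blast+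
    then show False using qyt_same_column[of T D m p q] T assms by (auto simp: qyt_last_def)
  qed
  then show ?thesis by blast
qed

text \<open>A box further right in the row of the rightmost maximal entry would be maximal as well,
  and a box above it would exceed the maximum; so that entry sits in a corner.\<close>

lemma qyt_last_exists:
  assumes "finite D" "D \<noteq> {}" and T: "T \<in> qyt D m"
  shows "\<exists>p\<in>corners D. T \<in> qyt_last D m p"
proof -
  define C where "C = {b \<in> D. int (T b) = m}"
  have "Max (T ` D) \<in> T ` D" using assms by (intro Max_in) auto
  then obtain b0 where "b0 \<in> D" "T b0 = Max (T ` D)" by (metis imageE)
  then have "b0 \<in> C" using T by (simp add: C_def qyt_def)
  then have "C \<noteq> {}" "finite C" using assms(1) unfolding C_def by (blast, simp)
  then obtain p where p: "p \<in> C" "\<And>b. b \<in> C \<Longrightarrow> snd b \<le> snd p"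
    using Max_in[of "snd ` C"] Max_ge[of "snd ` C"]
    by (metis (no_types, lifting) finite_imageI image_iff image_is_empty)
  obtain r c where rc: "p = (r, c)" by fastforce
  have pD: "(r, c) \<in> D" "int (T (r, c)) = m" using p rc by (auto simp: C_def)
  have "c' \<le> c" if "(r, c') \<in> D" for c'
  proof (rule ccontr)
    assume "\<not> c' \<le> c"
    then have "T (r, c) \<le> T (r, c')" using T that pD by (auto simp: qyt_def ssyt_def)
    then have "(r, c') \<in> C" using qyt_le[OF assms(1) T that] pD that by (simp add: C_def)
    then show False using p(2) \<open>\<not> c' \<le> c\<close> rc by fastforce
  qed
  moreover have "r' \<le> r" if "(r', c) \<in> D" for r'
  proof (rule ccontr)
    assume "\<not> r' \<le> r"
    then have "T (r, c) < T (r', c)" using T that pD by (auto simp: qyt_def ssyt_def)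
    then show False using qyt_le[OF assms(1) T that] pD by simp
  qed
  ultimately have "p \<in> corners D" using pD rc by (simp add: corners_def)
  moreover have "T \<in> qyt_last D m p" using T p by (auto simp: qyt_last_def C_def)
  ultimately show ?thesis by blast
qed

lemma card_UN_qyt_last:
  assumes "finite D" "A \<subseteq> D"
  shows "card (\<Union>q\<in>A. qyt_last D m q) = (\<Sum>q\<in>A. card (qyt_last D m q))"
proof (rule card_UN_disjoint)
  show "finite A" using assms finite_subset by blast
  show "\<forall>q\<in>A. finite (qyt_last D m q)" using assms(1) finite_qyt_last by blast
  show "\<forall>p\<in>A. \<forall>q\<in>A. p \<noteq> q \<longrightarrow> qyt_last D m p \<inter> qyt_last D m q = {}"
    using qyt_last_disjoint by blast
qed

lemma card_qyt_eq_sum_corners: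
  assumes "finite D" "D \<noteq> {}"
  shows "card (qyt D m) = (\<Sum>p\<in>corners D. card (qyt_last D m p))"
proof -
  have "qyt D m = (\<Union>p\<in>corners D. qyt_last D m p)"
  proof (intro equalityI subsetI)
    fix T assume "T \<in> qyt D m"
    then show "T \<in> (\<Union>p\<in>corners D. qyt_last D m p)" using qyt_last_exists[OF assms] by simp
  next
    fix T assume "T \<in> (\<Union>p\<in>corners D. qyt_last D m p)"
    then show "T \<in> qyt D m" by (auto simp: qyt_last_def)
  qed
  then show ?thesis using card_UN_qyt_last[OF assms(1) corners_subset] by simp
qed

text \<open>Only the condition linking \<open>m\<close> to \<open>m - 1\<close> can be affected. If
  \<open>m\<close> still occurs, another \<open>m\<close> lies further left than \<open>p\<close>
  and takes over its role. If not, \<open>p\<close> was the only \<open>m\<close>, and the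
  quasi-Yamanouchi condition at \<open>m\<close> provides an \<open>m - 1\<close> weakly right of
  \<open>p\<close>.\<close>

lemma remove_corner_mem:
  assumes fin: "finite D" and p: "p \<in> corners D" and ne: "D - {p} \<noteq> {}"
    and T: "T \<in> qyt_last D m p"
  defines "T' \<equiv> T(p := 0)" and "D' \<equiv> D - {p}"
  shows "(T' \<in> qyt D' m \<and> (\<forall>b\<in>D'. int (T' b) = m \<longrightarrow> snd b < snd p)) \<or>
         (T' \<in> qyt D' (m - 1) \<and> (\<exists>b\<in>D'. int (T' b) = m - 1 \<and> snd p \<le> snd b))"
proof -
  have TD: "T \<in> qyt D m" and Tp: "int (T p) = m" and pD: "p \<in> D"
    and lst: "\<And>b. b \<in> D \<Longrightarrow> int (T b) = m \<Longrightarrow> snd b \<le> snd p"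
    using T by (auto simp: qyt_last_def)
  have S: "ssyt D T" and Q: "quasi_yam D T" using TD by (auto simp: qyt_def)
  have le: "\<And>b. b \<in> D \<Longrightarrow> T b \<le> T p" using qyt_le[OF fin TD] Tp by fastforce
  have eq: "\<And>b. b \<in> D' \<Longrightarrow> T' b = T b" by (simp add: T'_def D'_def)
  have img: "T' ` D' = T ` D'" using eq by force
  have sub: "D' \<subseteq> D" and finD': "finite D'" using fin by (auto simp: D'_def)
  have S': "ssyt D' T'"
    using S eq sub unfolding ssyt_def
    by (smt (verit, best) D'_def Diff_iff T'_def fun_upd_apply singletonD subsetD)
  have Q': "quasi_yam D' T'" unfolding quasi_yam_def
  proof (intro allI impI)
    fix i assume i: "1 < i \<and> i \<in> T' ` D'"
    then obtain b0 where b0: "b0 \<in> D'" "T b0 = i" using img by auto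
    then obtain b b' where b: "b \<in> D" "b' \<in> D" "T b = i - 1" "T b' = i" "snd b' \<le> snd b"
      using Q i sub unfolding quasi_yam_def by (metis image_eqI subsetD)
    \<comment> \<open>The entry of \<open>p\<close> is maximal, whereas \<open>b\<close> holds
      \<open>i - 1\<close> and \<open>i\<close> still occurs.\<close>
    have "b \<noteq> p" using b b0 le[of b0] sub i by auto
    then have bD: "b \<in> D'" using b by (simp add: D'_def)
    show "\<exists>b\<in>D'. \<exists>b'\<in>D'. T' b = i - 1 \<and> T' b' = i \<and> snd b' \<le> snd b"
    proof (cases "b' = p")
      case True
      then have "snd b0 \<le> snd p" using lst[of b0] b0 sub b Tp by auto
      then show ?thesis using True b b0 bD eq by (metis order_trans)
    next
      case False
      then have "b' \<in> D'" using b by (simp add: D'_def)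
      then show ?thesis using b bD eq by metis
    qed
  qed
  show ?thesis
  proof (cases "T p \<in> T ` D'")
    case True
    then have "Max (T' ` D') = T p" unfolding img using finD' le sub by (intro Max_eqI) auto
    moreover have "snd b < snd p" if "b \<in> D'" "int (T b) = m" for b
      using lst[of b] qyt_same_column[OF TD, of b p] that Tp pD sub
      by (metis D'_def Diff_iff insertI1 nat_less_le of_nat_eq_iff subsetD)
    ultimately show ?thesis using S' Q' Tp eq by (auto simp: qyt_def)
  next
    case False
    have lt: "T b < T p" if "b \<in> D'" for b
      using le[of b] False that sub by (metis image_eqI le_neq_implies_less subsetD)
    obtain b1 where "b1 \<in> D'" using ne by (auto simp: D'_def)
    then have "0 < T b1" "T b1 < T p" using lt S sub by (auto simp: ssyt_def)
    then have "1 < T p" by linarith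
    then obtain b b' where b: "b \<in> D" "b' \<in> D" "T b = T p - 1" "T b' = T p" "snd b' \<le> snd b"
      using Q pD unfolding quasi_yam_def by (metis image_eqI)
    have "b' = p" using b lt[of b'] by (auto simp: D'_def)
    moreover have bD: "b \<in> D'" using b \<open>1 < T p\<close> by (auto simp: D'_def)
    moreover have "Max (T' ` D') = T p - 1"
      unfolding img
    proof (intro Max_eqI)
      show "T p - 1 \<in> T ` D'" using b(3) bD by (metis image_eqI)
    qed (use finD' lt in fastforce)+
    ultimately show ?thesis using S' Q' Tp eq[OF bD] b \<open>1 < T p\<close>
      by (auto simp: qyt_def of_nat_diff intro!: bexI[of _ b])
  qed
qed

text \<open>In both alternatives all other entries equal to \<open>m\<close> lie strictly left of
  \<open>p\<close>. This makes \<open>p\<close> the rightmost one and keeps its column strict; the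
  second alternative also supplies the \<open>m - 1\<close> required when \<open>m\<close> is
  new.\<close>

lemma add_corner_mem:
  fixes m :: int and T' :: "nat \<times> nat \<Rightarrow> nat"
  assumes fin: "finite D" and p: "p \<in> corners D" and ne: "D - {p} \<noteq> {}"
  defines "D' \<equiv> D - {p}" and "T \<equiv> T'(p := nat m)"
  assumes T': "(T' \<in> qyt D' m \<and> (\<forall>b\<in>D'. int (T' b) = m \<longrightarrow> snd b < snd p)) \<or>
         (T' \<in> qyt D' (m - 1) \<and> (\<exists>b\<in>D'. int (T' b) = m - 1 \<and> snd p \<le> snd b))"
  shows "T \<in> qyt_last D m p"
proof -
  have finD': "finite D'" using fin by (simp add: D'_def)
  have pD: "p \<in> D" and D: "D = insert p D'" and pD': "p \<notin> D'" using p by (auto simp: D'_def corners_def)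
  have S: "ssyt D' T'" and Q: "quasi_yam D' T'" using T' by (auto simp: qyt_def)
  obtain b1 where b1: "b1 \<in> D'" using ne by (auto simp: D'_def)
  have le: "int (T' b) \<le> m" if "b \<in> D'" for b
    using T' qyt_le[OF finD' _ that] by fastforce
  have "0 < T' b1" using S b1 by (auto simp: ssyt_def)
  then have m: "0 < m" using le[OF b1] by linarith
  have Tp: "T p = nat m" by (simp add: T_def)
  have eq: "\<And>b. b \<in> D' \<Longrightarrow> T b = T' b" using pD' by (auto simp: T_def)
  have le': "T b \<le> nat m" if "b \<in> D'" for b
    using le[OF that] eq[OF that] by linarith
  have max_col: "snd b < snd p" if "b \<in> D'" "T b = nat m" for b
    using T'
  proof
    assume "T' \<in> qyt D' m \<and> (\<forall>b\<in>D'. int (T' b) = m \<longrightarrow> snd b < snd p)"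
    then show ?thesis using that eq m by auto
  next
    assume "T' \<in> qyt D' (m - 1) \<and> (\<exists>b\<in>D'. int (T' b) = m - 1 \<and> snd p \<le> snd b)"
    then show ?thesis using that eq m qyt_le[OF finD', of T' "m - 1" b] by auto
  qed
  have "ssyt D T" unfolding ssyt_def
  proof (intro conjI allI impI ballI)
    fix b assume "b \<in> D" then show "0 < T b"
      using ssytD(1)[OF S, of b] m eq[of b] Tp unfolding D by auto
  next
    fix b assume "b \<notin> D" then show "T b = 0"
      using ssytD(2)[OF S, of b] unfolding D T_def by auto
  next
    fix r c c' assume a: "(r, c) \<in> D \<and> (r, c') \<in> D \<and> c \<le> c'"
    show "T (r, c) \<le> T (r, c')"
    proof (cases "(r, c) = (r, c')")
      case False
      then have "(r, c) \<noteq> p" using a p by (auto simp: corners_def)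
      then have c: "(r, c) \<in> D'" using a D by auto
      show ?thesis
      proof (cases "(r, c') = p")
        case True then show ?thesis using le'[OF c] Tp by simp
      next
        case False
        then have "(r, c') \<in> D'" using a D by auto
        then show ?thesis using c a ssytD(3-4)[OF S] eq by auto
      qed
    qed simp
  next
    fix r r' c assume a: "(r, c) \<in> D \<and> (r', c) \<in> D \<and> r < r'"
    then have "(r, c) \<noteq> p" using p by (auto simp: corners_def)
    then have c: "(r, c) \<in> D'" using a D by auto
    show "T (r, c) < T (r', c)"
    proof (cases "(r', c) = p")
      case True
      then show ?thesis using le'[OF c] max_col[OF c] Tp by fastforce
    next
      case False
      then have "(r', c) \<in> D'" using a D by auto
      then show ?thesis using c a ssytD(3-4)[OF S] eq by auto
    qed
  qed
  moreover have "quasi_yam D T" unfolding quasi_yam_def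
  proof (intro allI impI)
    fix i assume i: "1 < i \<and> i \<in> T ` D"
    show "\<exists>b\<in>D. \<exists>b'\<in>D. T b = i - 1 \<and> T b' = i \<and> snd b' \<le> snd b"
    proof (cases "i \<in> T' ` D'")
      case True
      then obtain b b' where "b \<in> D'" "b' \<in> D'" "T' b = i - 1" "T' b' = i" "snd b' \<le> snd b"
        using Q i unfolding quasi_yam_def by meson
      then show ?thesis using eq D by (metis insertI2)
    next
      case False
      then have im: "i = nat m" using i eq Tp D by auto
      \<comment> \<open>The value \<open>m\<close> is new, which rules out the first alternative on
        \<open>T'\<close>.\<close>
      have "m \<notin> (\<lambda>b. int (T' b)) ` D'" using False im by auto
      then have "T' \<notin> qyt D' m" using qyt_last_exists[OF finD', of T' m] b1
        by (auto simp: qyt_last_def)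
      then obtain b where "b \<in> D'" "int (T' b) = m - 1" "snd p \<le> snd b" using T' by blast
      then show ?thesis using Tp im eq pD D
        by (intro bexI[of _ b] bexI[of _ p]) auto
    qed
  qed
  moreover have "Max (T ` D) = nat m"
    using fin le' Tp pD D by (intro Max_eqI) auto
  ultimately show ?thesis using m pD Tp max_col D
    by (auto simp: qyt_last_def qyt_def less_imp_le)
qed

text \<open>Deleting the entry in \<open>p\<close> is a bijection onto the two alternatives, which
  are disjoint because their largest entries differ. Each is then sorted by the corner
  \<open>q\<close> of its rightmost maximal entry: the condition on \<open>p\<close> depends only on
  the column of \<open>q\<close>.\<close>

lemma card_qyt_last_remove:
  assumes fin: "finite D" and p: "p \<in> corners D" and ne: "D - {p} \<noteq> {}"
  shows "card (qyt_last D m p) =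
      (\<Sum>q\<in>{q \<in> corners (D - {p}). snd q < snd p}. card (qyt_last (D - {p}) m q))
    + (\<Sum>q\<in>{q \<in> corners (D - {p}). snd p \<le> snd q}. card (qyt_last (D - {p}) (m - 1) q))"
proof -
  define D' where "D' = D - {p}"
  have finD': "finite D'" and neD': "D' \<noteq> {}" and pD': "p \<notin> D'" using fin ne by (auto simp: D'_def)
  define A where "A = {T \<in> qyt D' m. \<forall>b\<in>D'. int (T b) = m \<longrightarrow> snd b < snd p}"
  define B where "B = {T \<in> qyt D' (m - 1). \<exists>b\<in>D'. int (T b) = m - 1 \<and> snd p \<le> snd b}"
  have "bij_betw (\<lambda>T. T(p := 0)) (qyt_last D m p) (A \<union> B)"
  proof (rule bij_betw_byWitness[where f' = "\<lambda>T. T(p := nat m)"])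
    show "\<forall>T\<in>qyt_last D m p. (T(p := 0))(p := nat m) = T"
      by (auto simp: qyt_last_def)
    show "\<forall>T\<in>A \<union> B. (T(p := nat m))(p := 0) = T"
    proof
      \<comment> \<open>Fillings are 0 outside their shape, so resetting \<open>p\<close> to 0
        recovers \<open>T\<close>.\<close>
      fix T assume "T \<in> A \<union> B"
      then have "T p = 0" using pD' ssytD(2)[of D' T p] by (auto simp: A_def B_def qyt_def)
      then show "(T(p := nat m))(p := 0) = T" by auto
    qed
    show "(\<lambda>T. T(p := 0)) ` qyt_last D m p \<subseteq> A \<union> B"
      using remove_corner_mem[OF fin p ne] unfolding A_def B_def D'_def by blast
    show "(\<lambda>T. T(p := nat m)) ` (A \<union> B) \<subseteq> qyt_last D m p"
      using add_corner_mem[OF fin p ne] unfolding A_def B_def D'_def by blast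
  qed
  then have "card (qyt_last D m p) = card (A \<union> B)" by (rule bij_betw_same_card)
  also have "\<dots> = card A + card B"
  proof (rule card_Un_disjoint)
    show "finite A" "finite B" using finite_qyt[OF finD'] by (simp_all add: A_def B_def)
    show "A \<inter> B = {}" by (auto simp: A_def B_def qyt_def)
  qed
  also have "A = (\<Union>q\<in>{q \<in> corners D'. snd q < snd p}. qyt_last D' m q)"
  proof (intro equalityI subsetI)
    fix T assume T: "T \<in> A"
    then obtain q where q: "q \<in> corners D'" "T \<in> qyt_last D' m q"
      using qyt_last_exists[OF finD' neD', of T m] unfolding A_def by blast
    then have "snd q < snd p" using T unfolding A_def qyt_last_def by blast
    then show "T \<in> (\<Union>q\<in>{q \<in> corners D'. snd q < snd p}. qyt_last D' m q)"
      using q by blast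
  next
    fix T assume "T \<in> (\<Union>q\<in>{q \<in> corners D'. snd q < snd p}. qyt_last D' m q)"
    then obtain q where "snd q < snd p" "T \<in> qyt_last D' m q" by blast
    then show "T \<in> A" by (fastforce simp: A_def qyt_last_def)
  qed
  also have "B = (\<Union>q\<in>{q \<in> corners D'. snd p \<le> snd q}. qyt_last D' (m - 1) q)"
  proof (intro equalityI subsetI)
    fix T assume T: "T \<in> B"
    then obtain q where q: "q \<in> corners D'" "T \<in> qyt_last D' (m - 1) q"
      using qyt_last_exists[OF finD' neD', of T "m - 1"] unfolding B_def by blast
    obtain b where "b \<in> D'" "int (T b) = m - 1" "snd p \<le> snd b" using T by (auto simp: B_def)
    then have "snd p \<le> snd q" using q by (auto simp: qyt_last_def intro: order_trans)
    then show "T \<in> (\<Union>q\<in>{q \<in> corners D'. snd p \<le> snd q}. qyt_last D' (m - 1) q)"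
      using q by blast
  next
    fix T assume "T \<in> (\<Union>q\<in>{q \<in> corners D'. snd p \<le> snd q}. qyt_last D' (m - 1) q)"
    then obtain q where "snd p \<le> snd q" "T \<in> qyt_last D' (m - 1) q" by blast
    then show "T \<in> B" unfolding B_def qyt_last_def by blast
  qed
  finally show ?thesis
    using corners_subset[of D'] unfolding D'_def[symmetric]
    by (subst (asm) (1 2) card_UN_qyt_last[OF finD']) auto
qed

text \<open>No remaining corner is weakly right of \<open>p\<close>, so only the first sum survives
  and it runs over all corners.\<close>

lemma card_qyt_last_rightmost:
  assumes "finite D" "p \<in> corners D" "D - {p} \<noteq> {}" and "\<And>q. q \<in> D - {p} \<Longrightarrow> snd q < snd p"
  shows "card (qyt_last D m p) = card (qyt (D - {p}) m)"
proof -
  have sets: "{q \<in> corners (D - {p}). snd q < snd p} = corners (D - {p})"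
    "{q \<in> corners (D - {p}). snd p \<le> snd q} = {}"
    using assms(4) corners_subset[of "D - {p}"] by fastforce+
  have "finite (D - {p})" using assms(1) by simp
  from card_qyt_eq_sum_corners[OF this assms(3)] show ?thesis
    unfolding card_qyt_last_remove[OF assms(1-3)] sets by (simp only: sum.empty add_0_right)
qed

text \<open>No column lies left of column 0, so only the second sum survives and the largest entry
  drops by one.\<close>

lemma card_qyt_last_leftmost:
  assumes "finite D" "p \<in> corners D" "D - {p} \<noteq> {}" and "snd p = 0"
  shows "card (qyt_last D m p) = card (qyt (D - {p}) (m - 1))"
proof -
  have sets: "{q \<in> corners (D - {p}). snd q < snd p} = {}"
    "{q \<in> corners (D - {p}). snd p \<le> snd q} = corners (D - {p})"
    using assms(4) by auto
  have "finite (D - {p})" using assms(1) by simp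
  from card_qyt_eq_sum_corners[OF this assms(3)] show ?thesis
    unfolding card_qyt_last_remove[OF assms(1-3)] sets by (simp only: sum.empty add_0)
qed

lemma card_qyt_column_split:
  assumes "finite D" "D \<noteq> {}"
  shows "card (qyt D m) =
      (\<Sum>q\<in>{q \<in> corners D. snd q < s}. card (qyt_last D m q))
    + (\<Sum>q\<in>{q \<in> corners D. s \<le> snd q}. card (qyt_last D m q))"
proof -
  have "finite (corners D)" using assms(1) corners_subset finite_subset by blast
  moreover have "corners D - {q \<in> corners D. snd q < s} = {q \<in> corners D. s \<le> snd q}" by auto
  ultimately show ?thesis
    using sum.subset_diff[of "{q \<in> corners D. snd q < s}" "corners D" "\<lambda>q. card (qyt_last D m q)"]
    unfolding card_qyt_eq_sum_corners[OF assms] by simp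
qed

text \<open>The first sum of \<open>card_qyt_last_remove\<close> is the full count without the
  contribution of \<open>q0\<close>; that contribution is added on the left to avoid subtraction of
  natural numbers.\<close>

lemma card_qyt_last_one_right:
  assumes "finite D" "p \<in> corners D" "D - {p} \<noteq> {}"
    and "{q \<in> corners (D - {p}). snd p \<le> snd q} = {q0}"
  shows "card (qyt_last D m p) + card (qyt_last (D - {p}) m q0)
    = card (qyt (D - {p}) m) + card (qyt_last (D - {p}) (m - 1) q0)"
proof -
  have "finite (D - {p})" using assms(1) by simp
  from card_qyt_column_split[OF this assms(3), of m "snd p"] show ?thesis
    unfolding card_qyt_last_remove[OF assms(1-3)] assms(4) by simp
qed

lemma card_qyt_last_one_left:
  assumes "finite D" "p \<in> corners D" "D - {p} \<noteq> {}"
    and "{q \<in> corners (D - {p}). snd q < snd p} = {q0}"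
  shows "card (qyt_last D m p) + card (qyt_last (D - {p}) (m - 1) q0)
    = card (qyt (D - {p}) (m - 1)) + card (qyt_last (D - {p}) m q0)"
proof -
  have "finite (D - {p})" using assms(1) by simp
  from card_qyt_column_split[OF this assms(3), of "m - 1" "snd p"] show ?thesis
    unfolding card_qyt_last_remove[OF assms(1-3)] assms(4) by simp
qed

section \<open>Hooks\<close>

text \<open>The hook with arm length \<open>a\<close> and leg length \<open>c\<close>, that is
  (\<open>a\<close> | \<open>c\<close>) in Frobenius notation.\<close>

definition hook :: "nat \<Rightarrow> nat \<Rightarrow> (nat \<times> nat) set" where
  "hook a c = {(i, j). i = 0 \<and> j \<le> a \<or> j = 0 \<and> i \<le> c}"

lemma finite_hook: "finite (hook a c)"
  by (rule finite_subset[of _ "{..c} \<times> {..a}"]) (auto simp: hook_def)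

lemma corners_hook:
  "corners (hook a c) = (if a = 0 \<and> c = 0 then {(0, 0)}
     else (if a > 0 then {(0, a)} else {}) \<union> (if c > 0 then {(c, 0)} else {}))"
  by (auto simp: corners_def hook_def)

lemma hook_remove_right: "hook (Suc a) c - {(0, Suc a)} = hook a c"
  by (auto simp: hook_def)

lemma hook_remove_top: "hook a (Suc c) - {(Suc c, 0)} = hook a c"
  by (auto simp: hook_def)

lemma origin_in_hook: "(0, 0) \<in> hook a c"
  by (simp add: hook_def)

lemma card_qyt_last_hook_right:
  "card (qyt_last (hook (Suc a) c) m (0, Suc a)) = card (qyt (hook a c) m)"
proof -
  have "card (qyt_last (hook (Suc a) c) m (0, Suc a)) = card (qyt (hook (Suc a) c - {(0, Suc a)}) m)"
  proof (rule card_qyt_last_rightmost)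
    show "(0, Suc a) \<in> corners (hook (Suc a) c)" by (simp add: corners_hook)
    show "hook (Suc a) c - {(0, Suc a)} \<noteq> {}" using origin_in_hook hook_remove_right by blast
    show "snd q < snd (0, Suc a)" if "q \<in> hook (Suc a) c - {(0, Suc a)}" for q
      using that by (auto simp: hook_def)
  qed (rule finite_hook)
  then show ?thesis by (simp only: hook_remove_right)
qed

lemma card_qyt_last_hook_top:
  "card (qyt_last (hook a (Suc c)) m (Suc c, 0)) = card (qyt (hook a c) (m - 1))"
proof -
  have "card (qyt_last (hook a (Suc c)) m (Suc c, 0)) = card (qyt (hook a (Suc c) - {(Suc c, 0)}) (m - 1))"
  proof (rule card_qyt_last_leftmost)
    show "(Suc c, 0) \<in> corners (hook a (Suc c))" by (simp add: corners_hook)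
    show "hook a (Suc c) - {(Suc c, 0)} \<noteq> {}" using origin_in_hook hook_remove_top by blast
  qed (auto intro: finite_hook)
  then show ?thesis by (simp only: hook_remove_top)
qed

text \<open>An entry \<open>i > 1\<close> would require \<open>i - 1\<close> in another box.\<close>

lemma qyt_singleton: "qyt {p} m = (if m = 1 then {(\<lambda>_. 0)(p := 1)} else {})"
proof -
  have *: "T = (\<lambda>_. 0)(p := 1) \<and> m = 1" if "T \<in> qyt {p} m" for T
  proof -
    have S: "ssyt {p} T" and Q: "quasi_yam {p} T" and m: "int (T p) = m"
      using that by (auto simp: qyt_def)
    have "T p = 1" using Q ssytD(1)[OF S, of p] by (fastforce simp: quasi_yam_def)
    moreover have "T b = 0" if "b \<noteq> p" for b using ssytD(2)[OF S] that by simp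
    ultimately show ?thesis using m by auto
  qed
  have "(\<lambda>_. 0)(p := 1) \<in> qyt {p} 1"
    by (cases p) (auto simp: qyt_def ssyt_def quasi_yam_def)
  then have "qyt {p} m = {(\<lambda>_. 0)(p := 1)}" if "m = 1" using that * by blast
  moreover have "qyt {p} m = {}" if "m \<noteq> 1" using that * by blast
  ultimately show ?thesis by presburger
qed

text \<open>Removing the end of the row preserves the largest entry and removing the top of the
  column lowers it by one, so the counts follow Pascal's rule and only \<open>m = c + 1\<close> is
  possible.\<close>

lemma card_qyt_hook: "card (qyt (hook a c) m) = (if m = int c + 1 then (a + c) choose c else 0)"
proof (induction "a + c" arbitrary: a c m)
  case 0
  have "hook 0 0 = {(0, 0)}" by (auto simp: hook_def)
  then show ?case using 0 by (simp add: qyt_singleton)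
next
  case (Suc n)
  have sum: "card (qyt (hook a c) m) = (\<Sum>p\<in>corners (hook a c). card (qyt_last (hook a c) m p))"
    using origin_in_hook by (intro card_qyt_eq_sum_corners finite_hook) blast
  show ?case
  proof (cases a)
    case 0
    then obtain c' where c: "c = Suc c'" using Suc.hyps(2) by (cases c) auto
    then show ?thesis using sum 0 Suc.hyps(1)[of 0 c' "m - 1"] Suc.hyps(2)
      by (auto simp: corners_hook card_qyt_last_hook_top)
  next
    case a: (Suc a')
    show ?thesis
    proof (cases c)
      case 0
      then show ?thesis using sum a Suc.hyps(1)[of a' 0 m] Suc.hyps(2)
        by (auto simp: corners_hook card_qyt_last_hook_right)
    next
      case c: (Suc c')
      then show ?thesis using sum a Suc.hyps(1)[of a' c m] Suc.hyps(1)[of a c' "m - 1"] Suc.hyps(2)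
        by (auto simp: corners_hook card_qyt_last_hook_right card_qyt_last_hook_top)
    qed
  qed
qed

section \<open>Shapes of Durfee size two\<close>

text \<open>Frobenius notation (\<open>a\<close>, \<open>b\<close> | \<open>c\<close>,
  \<open>d\<close>): arms and legs of the diagonal boxes (0, 0) and (1, 1), which explains the
  offset in \<open>Suc b\<close> and \<open>Suc d\<close>. It is the diagram of a partition when
  \<open>b < a\<close> and \<open>d < c\<close>.\<close>

definition durfee2 :: "nat \<Rightarrow> nat \<Rightarrow> nat \<Rightarrow> nat \<Rightarrow> (nat \<times> nat) set" where
  "durfee2 a b c d = {(i, j). i = 0 \<and> j \<le> a \<or> i = 1 \<and> j \<le> Suc b \<or> j = 0 \<and> i \<le> c \<or> j = 1 \<and> i \<le> Suc d}"

lemma finite_durfee2: "finite (durfee2 a b c d)"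
  by (rule finite_subset[of _ "{..c + d + 1} \<times> {..a + b + 1}"]) (auto simp: durfee2_def)

lemma origin_in_durfee2: "(0, 0) \<in> durfee2 a b c d"
  by (simp add: durfee2_def)

text \<open>For \<open>b = 0 < d\<close> the second row ends at (1, 1), below another box, and
  symmetrically for \<open>d = 0 < b\<close>. For \<open>b = d = 0\<close> both inner corners
  coincide at (1, 1).\<close>

lemma mem_corners_durfee2_iff:
  assumes "b < a" "d < c"
  shows "(i, j) \<in> corners (durfee2 a b c d) \<longleftrightarrow>
    i = 0 \<and> j = a \<and> Suc b < a \<or> i = c \<and> j = 0 \<and> Suc d < c \<or>
    i = 1 \<and> j = Suc b \<and> (0 < b \<or> d = 0) \<or> i = Suc d \<and> j = 1 \<and> (0 < d \<or> b = 0)"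
    (is "?L \<longleftrightarrow> ?R")
proof
  assume L: ?L
  then have "(i, Suc j) \<notin> durfee2 a b c d" "(Suc i, j) \<notin> durfee2 a b c d" "(i, j) \<in> durfee2 a b c d"
    by (fastforce simp: corners_def)+
  then have "\<not> (i = 0 \<and> Suc j \<le> a \<or> i = 1 \<and> Suc j \<le> Suc b \<or> j = 0 \<and> i \<le> Suc d)"
    "\<not> (i = 0 \<and> j \<le> Suc b \<or> j = 0 \<and> Suc i \<le> c \<or> j = 1 \<and> Suc i \<le> Suc d)"
    "i = 0 \<and> j \<le> a \<or> i = 1 \<and> j \<le> Suc b \<or> j = 0 \<and> i \<le> c \<or> j = 1 \<and> i \<le> Suc d"
    by (simp_all add: durfee2_def)
  note R = this
  consider "i = 0" | "i = 1" | "i \<ge> 2" "j = 0" | "i \<ge> 2" "j = 1" | "i \<ge> 2" "j \<ge> 2" by linarith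
  then show ?R
  proof cases
    case 1 then show ?thesis using R assms by simp
  next
    case 2 then show ?thesis using R assms by (cases "j = 0"; cases "j = 1"; auto)
  qed (use R assms in auto)
next
  assume ?R
  then consider "i = 0" "j = a" "Suc b < a" | "i = c" "j = 0" "Suc d < c"
    | "i = 1" "j = Suc b" "0 < b \<or> d = 0" | "i = Suc d" "j = 1" "0 < d \<or> b = 0" by blast
  then show ?L using assms by cases (auto simp: corners_def durfee2_def)
qed

lemma corners_durfee2:
  assumes "b < a" "d < c"
  shows "corners (durfee2 a b c d) =
    (if Suc b < a then {(0, a)} else {}) \<union> (if Suc d < c then {(c, 0)} else {})
    \<union> (if 0 < b \<or> d = 0 then {(1, Suc b)} else {}) \<union> (if 0 < d \<or> b = 0 then {(Suc d, 1)} else {})"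
proof (rule set_eqI)
  fix p :: "nat \<times> nat"
  obtain i j where "p = (i, j)" by fastforce
  then show "p \<in> corners (durfee2 a b c d) \<longleftrightarrow> p \<in>
    (if Suc b < a then {(0, a)} else {}) \<union> (if Suc d < c then {(c, 0)} else {})
    \<union> (if 0 < b \<or> d = 0 then {(1, Suc b)} else {}) \<union> (if 0 < d \<or> b = 0 then {(Suc d, 1)} else {})"
    by (simp add: mem_corners_durfee2_iff[OF assms] disj_assoc)
qed

section \<open>Removing a corner from a shape of Durfee size two\<close>

lemma durfee2_remove_row1: "Suc b < Suc a \<Longrightarrow> durfee2 (Suc a) b c d - {(0, Suc a)} = durfee2 a b c d"
  by (auto simp: durfee2_def)

lemma durfee2_remove_col1: "Suc d < Suc c \<Longrightarrow> durfee2 a b (Suc c) d - {(Suc c, 0)} = durfee2 a b c d"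
  by (auto simp: durfee2_def)

lemma durfee2_remove_row2: "durfee2 a (Suc b) c d - {(1, Suc (Suc b))} = durfee2 a b c d"
  by (auto simp: durfee2_def)

lemma durfee2_remove_col2: "durfee2 a b c (Suc d) - {(Suc (Suc d), 1)} = durfee2 a b c d"
  by (auto simp: durfee2_def)

lemma durfee2_remove_middle: "0 < a \<Longrightarrow> 0 < c \<Longrightarrow> durfee2 a 0 c 0 - {(1, 1)} = hook a c"
  by (auto simp: durfee2_def hook_def)

lemma card_qyt_last_row1:
  assumes "b < a" "d < c"
  shows "card (qyt_last (durfee2 (Suc a) b c d) m (0, Suc a)) = card (qyt (durfee2 a b c d) m)"
proof -
  have rem: "durfee2 (Suc a) b c d - {(0, Suc a)} = durfee2 a b c d"
    using assms durfee2_remove_row1 by simp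
  have "card (qyt_last (durfee2 (Suc a) b c d) m (0, Suc a))
      = card (qyt (durfee2 (Suc a) b c d - {(0, Suc a)}) m)"
  proof (rule card_qyt_last_rightmost)
    show "(0, Suc a) \<in> corners (durfee2 (Suc a) b c d)"
      using assms by (simp add: mem_corners_durfee2_iff)
    show "durfee2 (Suc a) b c d - {(0, Suc a)} \<noteq> {}" using origin_in_durfee2 rem by blast
    show "snd q < snd (0, Suc a)" if "q \<in> durfee2 (Suc a) b c d - {(0, Suc a)}" for q
      using that assms by (auto simp: durfee2_def)
  qed (rule finite_durfee2)
  then show ?thesis by (simp only: rem)
qed

lemma card_qyt_last_col1:
  assumes "b < a" "d < c"
  shows "card (qyt_last (durfee2 a b (Suc c) d) m (Suc c, 0)) = card (qyt (durfee2 a b c d) (m - 1))"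
proof -
  have rem: "durfee2 a b (Suc c) d - {(Suc c, 0)} = durfee2 a b c d"
    using assms durfee2_remove_col1 by simp
  have "card (qyt_last (durfee2 a b (Suc c) d) m (Suc c, 0))
      = card (qyt (durfee2 a b (Suc c) d - {(Suc c, 0)}) (m - 1))"
  proof (rule card_qyt_last_leftmost)
    show "(Suc c, 0) \<in> corners (durfee2 a b (Suc c) d)"
      using assms by (simp add: mem_corners_durfee2_iff)
    show "durfee2 a b (Suc c) d - {(Suc c, 0)} \<noteq> {}" using origin_in_durfee2 rem by blast
  qed (simp_all add: finite_durfee2)
  then show ?thesis by (simp only: rem)
qed

text \<open>Once the end of the second row is gone, the end of the first row is the only corner
  weakly right of it. Tableaux with their rightmost maximal entry there are counted by deleting that
  box as well.\<close>

lemma card_qyt_last_row2: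
  assumes "b < a" "d < c"
  shows "card (qyt_last (durfee2 (Suc a) (Suc b) c d) m (1, Suc (Suc b))) + card (qyt (durfee2 a b c d) m)
    = card (qyt (durfee2 (Suc a) b c d) m) + card (qyt (durfee2 a b c d) (m - 1))"
proof -
  let ?D = "durfee2 (Suc a) (Suc b) c d" and ?p = "(1, Suc (Suc b))"
  have p: "?p \<in> corners ?D" using assms by (simp add: mem_corners_durfee2_iff)
  have ne: "?D - {?p} \<noteq> {}" using origin_in_durfee2 durfee2_remove_row2 by blast
  have q: "{q \<in> corners (?D - {?p}). snd ?p \<le> snd q} = {(0, Suc a)}"
    unfolding durfee2_remove_row2 using assms by (auto simp: mem_corners_durfee2_iff)
  show ?thesis
    using card_qyt_last_one_right[OF finite_durfee2 p ne q, of m] assms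
    by (simp only: durfee2_remove_row2 card_qyt_last_row1)
qed

text \<open>Here the only corner strictly left is the top of the first column. Deleting it costs one
  more unit of the largest entry, which is where \<open>m - 2\<close> comes from.\<close>

lemma card_qyt_last_col2:
  assumes "b < a" "d < c"
  shows "card (qyt_last (durfee2 a b (Suc c) (Suc d)) m (Suc (Suc d), 1)) + card (qyt (durfee2 a b c d) (m - 2))
    = card (qyt (durfee2 a b (Suc c) d) (m - 1)) + card (qyt (durfee2 a b c d) (m - 1))"
proof -
  let ?D = "durfee2 a b (Suc c) (Suc d)" and ?p = "(Suc (Suc d), 1)"
  have p: "?p \<in> corners ?D" using assms by (simp add: mem_corners_durfee2_iff)
  have ne: "?D - {?p} \<noteq> {}" using origin_in_durfee2 durfee2_remove_col2 by blast
  have q: "{q \<in> corners (?D - {?p}). snd q < snd ?p} = {(Suc c, 0)}"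
    unfolding durfee2_remove_col2 using assms by (auto simp: mem_corners_durfee2_iff)
  have "m - 1 - 1 = m - 2" by simp
  then show ?thesis
    using card_qyt_last_one_left[OF finite_durfee2 p ne q, of m] assms
    by (simp only: durfee2_remove_col2 card_qyt_last_col1)
qed

text \<open>The remaining hook has one corner strictly left and one strictly right of (1, 1). Both
  terms end at \<open>m - 1\<close>: on the left the drop comes from the second deletion, on the
  right from the first.\<close>

lemma card_qyt_last_middle:
  "card (qyt_last (durfee2 (Suc a) 0 (Suc c) 0) m (1, 1)) =
     card (qyt (hook (Suc a) c) (m - 1)) + card (qyt (hook a (Suc c)) (m - 1))"
proof -
  let ?D = "durfee2 (Suc a) 0 (Suc c) 0" and ?p = "(1, 1) :: nat \<times> nat"
  have rem: "?D - {?p} = hook (Suc a) (Suc c)" by (intro durfee2_remove_middle) simp_all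
  have q: "{q \<in> corners (?D - {?p}). snd q < snd ?p} = {(Suc c, 0)}"
    "{q \<in> corners (?D - {?p}). snd ?p \<le> snd q} = {(0, Suc a)}"
    unfolding rem by (auto simp: corners_hook)
  have p: "?p \<in> corners ?D" by (simp add: mem_corners_durfee2_iff)
  have ne: "?D - {?p} \<noteq> {}" using origin_in_hook rem by blast
  show ?thesis
    unfolding card_qyt_last_remove[OF finite_durfee2 p ne] q
    unfolding rem by (simp add: card_qyt_last_hook_right card_qyt_last_hook_top)
qed

text \<open>Induction on the size of the shape: the count, split over the corners, and the formula
  obey the same recurrence. The argument \<open>m - 1\<close> reflects \<open>k + 1\<close> being
  the largest entry.\<close>

lemma card_qyt_durfee2:
  assumes "b < a" "d < c"
  shows "real (card (qyt (durfee2 a b c d) m)) = descent_formula a b c d (m - 1)"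
  using assms
proof (induction "a + b + c + d" arbitrary: a b c d m rule: less_induct)
  case less
  note IH = less.hyps
  let ?D = "durfee2 a b c d"
  define L where "L p = real (card (qyt_last ?D m p))" for p
  obtain a' c' where a: "a = Suc a'" and c: "c = Suc c'"
    using less.prems by (metis less_imp_Suc_add)
  have "?D \<noteq> {}" using origin_in_durfee2 by blast
  then have sum: "real (card (qyt ?D m)) = sum L (corners ?D)"
    using card_qyt_eq_sum_corners[OF finite_durfee2, of a b c d m] by (simp add: L_def)
  have row1: "sum L (if Suc b < a then {(0, a)} else {}) = descent_formula (int a - 1) b c d (m - 1)"
  proof (cases "Suc b < a")
    case True
    then show ?thesis
      using IH[of a' b c d m] less.prems a by (simp add: L_def card_qyt_last_row1)
  next
    case False
    \<comment> \<open>The end of the first row is not a corner, and the formula vanishes at equal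
      arms.\<close>
    then have "int a - 1 = int b" using less.prems by simp
    then show ?thesis using False by simp
  qed
  have col1: "sum L (if Suc d < c then {(c, 0)} else {}) = descent_formula a b (int c - 1) d (m - 2)"
  proof (cases "Suc d < c")
    case True
    then show ?thesis
      using IH[of a b c' d "m - 1"] less.prems c by (simp add: L_def card_qyt_last_col1)
  next
    case False
    then have "int c - 1 = int d" using less.prems by simp
    then show ?thesis using False by simp
  qed
  show ?case
  \<comment> \<open>With both coordinates 0 the inner corners merge into one box and the recurrence
    has hook terms instead.\<close>
  proof (cases "b = 0 \<and> d = 0")
    case True
    have "corners ?D = (if Suc b < a then {(0, a)} else {}) \<union> (if Suc d < c then {(c, 0)} else {}) \<union> {(1, 1)}"
      using corners_durfee2[OF less.prems] True by simp
    then have "sum L (corners ?D) = sum L (if Suc b < a then {(0, a)} else {})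
        + sum L (if Suc d < c then {(c, 0)} else {}) + L (1, 1)"
      using True less.prems by (auto simp: sum.union_disjoint)
    moreover have "L (1, 1) = (if m - 1 = int c' + 1 then real (Suc (a' + c') choose c') else 0)
        + (if m - 1 = int c' + 2 then real (Suc (a' + c') choose Suc c') else 0)"
    proof -
      have "L (1, 1) = real (card (qyt_last (durfee2 (Suc a') 0 (Suc c') 0) m (1, 1)))"
        using True a c by (simp add: L_def)
      then show ?thesis
        unfolding card_qyt_last_middle card_qyt_hook by (simp del: binomial_Suc_Suc)
    qed
    ultimately show ?thesis
      using sum row1 col1 True a c descent_formula_near_hook_recurrence[of a' c' "m - 1"] by simp
  next
    case False
    \<comment> \<open>For \<open>b = 0\<close> the left side is empty and each term on the right
      contains the coordinate -1, hence is 0.\<close>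
    have row2: "sum L (if 0 < b then {(1, Suc b)} else {}) =
        descent_formula a (int b - 1) c d (m - 1) - descent_formula (int a - 1) (int b - 1) c d (m - 1)
        + descent_formula (int a - 1) (int b - 1) c d (m - 2)"
    proof (cases b)
      case (Suc b')
      then have "L (1, Suc b) + real (card (qyt (durfee2 a' b' c d) m))
          = real (card (qyt (durfee2 a b' c d) m)) + real (card (qyt (durfee2 a' b' c d) (m - 1)))"
        using card_qyt_last_row2[of b' a' d c m] less.prems a
        by (simp add: L_def flip: of_nat_add)
      then show ?thesis
        using IH[of a' b' c d m] IH[of a b' c d m] IH[of a' b' c d "m - 1"] less.prems a Suc by simp
    qed simp
    have col2: "sum L (if 0 < d then {(Suc d, 1)} else {}) =
        descent_formula a b c (int d - 1) (m - 2) - descent_formula a b (int c - 1) (int d - 1) (m - 3)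
        + descent_formula a b (int c - 1) (int d - 1) (m - 2)"
    proof (cases d)
      case (Suc d')
      then have "L (Suc d, 1) + real (card (qyt (durfee2 a b c' d') (m - 2)))
          = real (card (qyt (durfee2 a b c d') (m - 1))) + real (card (qyt (durfee2 a b c' d') (m - 1)))"
        using card_qyt_last_col2[of b a d' c' m] less.prems c
        by (simp add: L_def flip: of_nat_add)
      then show ?thesis
        using IH[of a b c' d' "m - 2"] IH[of a b c d' "m - 1"] IH[of a b c' d' "m - 1"] less.prems c Suc
        by simp
    qed simp
    have "corners ?D = (if Suc b < a then {(0, a)} else {}) \<union> (if Suc d < c then {(c, 0)} else {})
        \<union> (if 0 < b then {(1, Suc b)} else {}) \<union> (if 0 < d then {(Suc d, 1)} else {})"
      using corners_durfee2[OF less.prems] False by auto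
    then have "sum L (corners ?D) = sum L (if Suc b < a then {(0, a)} else {})
        + sum L (if Suc d < c then {(c, 0)} else {})
        + sum L (if 0 < b then {(1, Suc b)} else {}) + sum L (if 0 < d then {(Suc d, 1)} else {})"
      using less.prems by (auto simp: sum.union_disjoint)
    then show ?thesis
      unfolding sum row1 col1 row2 col2
      using descent_formula_recurrence[of b a d c "m - 1"] less.prems False by simp
  qed
qed

section \<open>Translation to the row-length description\<close>

lemma young_diagram_two_column_shape:
  assumes "l1 \<ge> l2" "l2 \<ge> 2" "h1 \<ge> h2" "h2 \<ge> 2"
  shows "young_diagram (two_column_shape l1 l2 h1 h2) = durfee2 (l1 - 1) (l2 - 2) (h1 - 1) (h2 - 2)"
proof (rule set_eqI)
  fix p :: "nat \<times> nat"
  obtain i j where p: "p = (i, j)" by fastforce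
  have len: "length (two_column_shape l1 l2 h1 h2) = h1"
    using assms by (simp add: two_column_shape_def)
  have nth: "two_column_shape l1 l2 h1 h2 ! i
      = (if i = 0 then l1 else if i = 1 then l2 else if i < h2 then 2 else 1)" if "i < h1"
    using assms that by (auto simp: two_column_shape_def nth_append nth_Cons')
  show "p \<in> young_diagram (two_column_shape l1 l2 h1 h2)
      \<longleftrightarrow> p \<in> durfee2 (l1 - 1) (l2 - 2) (h1 - 1) (h2 - 2)"
  proof (cases "i < h1")
    case True
    then show ?thesis using assms p len nth
      by (auto simp: young_diagram_def durfee2_def split: if_splits)
  next
    case False
    then show ?thesis using assms p len by (auto simp: young_diagram_def durfee2_def)
  qed
qed

text \<open>The minimum of a finite nonempty set of columns is at most \<open>x\<close> exactly if
  some member is.\<close>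

lemma quasi_yamanouchi_iff_quasi_yam:
  assumes "finite (young_diagram lam)"
  shows "is_quasi_yamanouchi lam T \<longleftrightarrow> quasi_yam (young_diagram lam) T"
proof -
  let ?D = "young_diagram lam"
  have "leftmost_col lam T i \<le> x \<longleftrightarrow> (\<exists>b'\<in>?D. T b' = i \<and> snd b' \<le> x)" if "i \<in> T ` ?D" for i x
  proof -
    let ?C = "{c. \<exists>r. (r, c) \<in> ?D \<and> T (r, c) = i}"
    have C: "?C = snd ` {b \<in> ?D. T b = i}" by force
    then have "finite ?C" using assms by simp
    moreover have "?C \<noteq> {}" using that unfolding C by blast
    ultimately have "leftmost_col lam T i \<le> x \<longleftrightarrow> (\<exists>y\<in>?C. y \<le> x)"
      unfolding leftmost_col_def by (rule Min_le_iff)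
    then show ?thesis unfolding C by blast
  qed
  then show ?thesis unfolding is_quasi_yamanouchi_def quasi_yam_def by blast
qed

lemma QYT_eq_eq_qyt:
  assumes "finite (young_diagram lam)"
  shows "QYT_eq lam m = qyt (young_diagram lam) (int m)"
  unfolding QYT_eq_def qyt_def quasi_yamanouchi_iff_quasi_yam[OF assms] is_SSYT_def ssyt_def by simp

text \<open>The slack variables \<open>e\<close>, \<open>f\<close>, \<open>p\<close>,
  \<open>q\<close> turn all factorial arguments into natural numbers without subtraction:
  \<open>k = c + p\<close>, \<open>r + 1 = k - d\<close> and \<open>q = b + c + d + 1 - k\<close>.
  The factor \<open>c - d = f + 1\<close> comes out of \<open>c choose d\<close>.\<close>

lemma descent_formula_eq_binomials:
  fixes b d e f p q :: nat
  assumes "p + q = b + d + 1"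
  defines "a \<equiv> b + 1 + e" and "c \<equiv> d + 1 + f" and "r \<equiv> p + f"
  shows "descent_formula a b c d (int (c + p)) =
     real (e + 1) / real (r + 1) * real ((a + c) choose r) * real ((b + c) choose r)
     * real (r choose p) * real ((b + d) choose d) * real ((a + d) choose d) / real (c choose d)"
proof -
  have binom: "real ((x + y) choose x) = fact (x + y) / (fact x * fact y)" for x y
    using binomial_fact[of x "x + y", where 'a = real] by simp
  have "real ((a + c) choose r) = fact (a + c) / (fact r * fact (q + e + 1))"
    using binom[of r "q + e + 1"] assms by (simp add: algebra_simps)
  moreover have "real ((b + c) choose r) = fact (b + c) / (fact r * fact q)"
    using binom[of r q] assms by (simp add: algebra_simps)
  moreover have "real (r choose p) = fact r / (fact p * fact f)"
    using binom[of p f] by (simp add: r_def)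
  moreover have "real ((b + d) choose d) = fact (b + d) / (fact d * fact b)"
    "real ((a + d) choose d) = fact (a + d) / (fact d * fact a)"
    using binom[of d b] binom[of d a] by (simp_all add: add.commute)
  moreover have "real (c choose d) = fact c / (fact d * (real (f + 1) * fact f))"
    using binom[of d "f + 1"] by (simp add: c_def add.assoc)
  ultimately have rhs: "real (e + 1) / real (r + 1) * real ((a + c) choose r) * real ((b + c) choose r)
     * real (r choose p) * real ((b + d) choose d) * real ((a + d) choose d) / real (c choose d)
     = real (e + 1) * real (f + 1) * (fact (a + c) * fact (b + c) * fact (b + d) * fact (a + d))
       * (1 / fact a * (1 / fact b) * (1 / fact c) * (1 / fact d))
       * (1 / (real (r + 1) * fact r) * (1 / fact p) * (1 / fact (q + e + 1)) * (1 / fact q))"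
    by (simp add: mult_ac)
  have "int (c + p) - int d = int (r + 1)" "int (c + p) - int c = int p"
    "int a + int c + int d + 1 - int (c + p) = int (q + e + 1)"
    "int b + int c + int d + 1 - int (c + p) = int q"
    "int a - int b = int (e + 1)" "int c - int d = int (f + 1)"
    "int a + int c = int (a + c)" "int b + int c = int (b + c)"
    "int b + int d = int (b + d)" "int a + int d = int (a + d)"
    using assms by simp_all
  moreover have "fact (r + 1) = real (r + 1) * fact r" by simp
  moreover have "inv_fact (int x) = 1 / fact x" for x by (simp add: inv_fact_def)
  ultimately show ?thesis
    unfolding descent_formula_def rhs by (simp only: nat_int of_int_of_nat_eq)
qed

theorem theorem4p1:
  fixes l1 l2 h1 h2 m n :: nat
  assumes "l1 \<ge> l2" "l2 \<ge> 2" "h1 \<ge> h2" "h2 \<ge> 2"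
    and "n = l1 + l2 + h1 + h2 - 4"
    and "h1 \<le> m" "m \<le> n - (l1 - 1)"
  shows "real (card (QYT_eq (two_column_shape l1 l2 h1 h2) m)) =
           real (l1 - l2 + 1) / real (m - h2 + 1)
         * real ((l1 + h1 - 2) choose (m - h2))
         * real ((l2 + h1 - 3) choose (m - h2))
         * real ((m - h2) choose (m - h1))
         * real ((l2 + h2 - 4) choose (h2 - 2))
         * real ((l1 + h2 - 3) choose (h2 - 2))
         / real ((h1 - 1) choose (h2 - 2))"
proof -
  \<comment> \<open>The bounds on \<open>m\<close> say exactly that \<open>m - h1\<close> and
    \<open>n - (l1 - 1) - m\<close> are nonnegative; these are \<open>p\<close> and
    \<open>q\<close>.\<close>
  define b d e f p q where "b = l2 - 2" and "d = h2 - 2" and "e = l1 - l2" and "f = h1 - h2"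
    and "p = m - h1" and "q = l2 + h1 + h2 - 3 - m"
  have params: "l2 = b + 2" "h2 = d + 2" "l1 = b + 2 + e" "h1 = d + 2 + f" "m = d + 2 + f + p"
    "p + q = b + d + 1"
    using assms by (simp_all add: b_def d_def e_def f_def p_def q_def)
  have diagram: "young_diagram (two_column_shape l1 l2 h1 h2) = durfee2 (b + 1 + e) b (d + 1 + f) d"
    using young_diagram_two_column_shape[OF assms(1-4)] by (simp add: params)
  have "real (card (QYT_eq (two_column_shape l1 l2 h1 h2) m))
      = real (card (qyt (durfee2 (b + 1 + e) b (d + 1 + f) d) (int m)))"
    by (simp only: QYT_eq_eq_qyt diagram finite_durfee2)
  also have "\<dots> = descent_formula (b + 1 + e) b (d + 1 + f) d (int m - 1)"
    by (rule card_qyt_durfee2) simp_all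
  also have "int m - 1 = int (d + 1 + f + p)" by (simp add: params)
  also have "descent_formula (b + 1 + e) b (d + 1 + f) d (int (d + 1 + f + p)) =
     real (e + 1) / real (p + f + 1) * real ((b + 1 + e + (d + 1 + f)) choose (p + f))
     * real ((b + (d + 1 + f)) choose (p + f)) * real ((p + f) choose p)
     * real ((b + d) choose d) * real ((b + 1 + e + d) choose d) / real ((d + 1 + f) choose d)"
    by (rule descent_formula_eq_binomials) (rule params)
  also have "b + 1 + e + (d + 1 + f) = l1 + h1 - 2" by (simp add: params)
  also have "b + (d + 1 + f) = l2 + h1 - 3" by (simp add: params)
  also have "b + 1 + e + d = l1 + h2 - 3" by (simp add: params)
  also have "b + d = l2 + h2 - 4" by (simp add: params)
  also have "d + 1 + f = h1 - 1" by (simp add: params)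
  also have "p + f = m - h2" by (simp add: params)
  also have "p = m - h1" by (simp add: p_def)
  also have "d = h2 - 2" by (simp add: d_def)
  also have "e = l1 - l2" by (simp add: e_def)
  finally show ?thesis .
qed

end
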